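(* Let $\ell,\mathsf d\ge1$. The fair dot product protocol $\Pi_{\mathsf{dotp}}(\vec{\mathbf a},\vec{\mathbf b},\mathsf{isTr})$ (described in the context) on $[\![\cdot]\!]$-shared vectors $\vec{\mathbf a},\vec{\mathbf b}\in\mathbb Z_{2^\ell}^{\mathsf d}$, for either value of the truncation bit $\mathsf{isTr}\in\{0,1\}$, requires (in the amortized sense) $2\ell$ bits of communication in preprocessing, and $1$ round and $3\ell$ bits of communication in the online phase.
   Context: Setting: four parties $P_0,P_1,P_2,P_3$ with pairwise private authenticated synchronous channels; every subset of at least two parties holds a common pseudorandom-function key (one-time setup), so any such subset can sample common random elements without communication. $\mathsf H$ is a collision-resistant hash function with output of fixed length. For $\mathsf x\in\mathbb Z_{2^\ell}$, $\mathsf x^{\mathsf t}$ is $\mathsf x$ (as a signed two's complement integer) truncated by a fixed number of low-order bits. Sharing: $\mathsf{v}\in\mathbb{Z}_{2^\ell}$ is $[\![\cdot]\!]$-shared via $\lambda^1_{\mathsf v},\lambda^2_{\mathsf v},\lambda^3_{\mathsf v}$ and $\mathsf{m}_{\mathsf v}=\mathsf v+\lambda_{\mathsf v}$, $\lambda_{\mathsf v}=\lambda^1_{\mathsf v}+\lambda^2_{\mathsf v}+\lambda^3_{\mathsf v}$, where $P_0$ holds $(\lambda^1_{\mathsf v},\lambda^2_{\mathsf v},\lambda^3_{\mathsf v})$, $P_1$ holds $(\mathsf m_{\mathsf v},\lambda^1_{\mathsf v},\lambda^3_{\mathsf v})$, $P_2$ holds $(\mathsf m_{\mathsf v},\lambda^2_{\mathsf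 v},\lambda^3_{\mathsf v})$, $P_3$ holds $(\mathsf m_{\mathsf v},\lambda^1_{\mathsf v},\lambda^2_{\mathsf v})$. Vectors are shared entrywise. The sharing is linear. Joint-send: "$P_i,P_j$ $\mathsf{jsnd}$ $\mathsf x$ to $P_k$" means $P_i$ sends $\mathsf x$ to $P_k$ and $P_j$ sends $\mathsf H(\mathsf x)$ to $P_k$, who aborts if they are inconsistent; hashes are combined over all instances and sent once at the end. Joint sharing $\Pi_{\mathsf{JSh}}$: $\Pi_{\mathsf{JSh}}(P_0,P_3,\mathsf v)$ (preprocessing): $P_0,P_2,P_3$ sample $\lambda^2_{\mathsf v}$; set $\lambda^3_{\mathsf v}=\mathsf m_{\mathsf v}=0$; $P_0,P_3$ $\mathsf{jsnd}$ $\lambda^1_{\mathsf v}=-\mathsf v-\lambda^2_{\mathsf v}$ to $P_1$. $\Pi_{\mathsf{JSh}}(P_1,P_2,\mathsf v)$ (online): in preprocessing the $\lambda$-shares are sampled non-interactively so that $P_1,P_2$ both know all of $\lambda_{\mathsf v}$; online $P_1,P_2$ $\mathsf{jsnd}$ $\mathsf m_{\mathsf v}=\mathsf v+\lambda_{\mathsf v}$ to $P_3$. Protocol $\Pi_{\mathsf{dotp}}$ for $\mathsf z=\sum_{i=1}^{\mathsf d}\mathsf a_i\mathsf b_i$ (all sums over $i=1,\dots,\mathsf d$). Preprocessing: (1) Locally, $P_0,P_1$ compute $\gamma^1=\sum_i(\lambda_{\mathsf a_i}^1\lambda_{\mathsf b_i}^3+\lambda_{\mathsf a_i}^3\lambda_{\mathsf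 b_i}^1+\lambda_{\mathsf a_i}^3\lambda_{\mathsf b_i}^3)$; $P_0,P_2$ compute $\gamma^2=\sum_i(\lambda_{\mathsf a_i}^2\lambda_{\mathsf b_i}^3+\lambda_{\mathsf a_i}^3\lambda_{\mathsf b_i}^2+\lambda_{\mathsf a_i}^2\lambda_{\mathsf b_i}^2)$; $P_0,P_3$ compute $\gamma^3=\sum_i(\lambda_{\mathsf a_i}^1\lambda_{\mathsf b_i}^2+\lambda_{\mathsf a_i}^2\lambda_{\mathsf b_i}^1+\lambda_{\mathsf a_i}^1\lambda_{\mathsf b_i}^1)$. (2) $P_0,P_3,P_j$ sample random $\mathsf u^j\in\mathbb Z_{2^\ell}$, $j\in\{1,2\}$. (3) $P_0,P_3$ compute $\mathsf r=\gamma^3-\mathsf u^1-\mathsf u^2$, set $\mathsf q=\mathsf r^{\mathsf t}$ if $\mathsf{isTr}=1$, else $\mathsf q=\mathsf r$, and execute $\Pi_{\mathsf{JSh}}(P_0,P_3,\mathsf q)$. (4) $P_0,P_1,P_2$ sample random $\mathsf s_1,\mathsf s_2$, set $\mathsf s=\mathsf s_1+\mathsf s_2$; $P_0$ sends $\mathsf w=\gamma^1+\gamma^2+\mathsf s$ to $P_3$. Online: (1) $P_1$ computes $\mathsf y_1=\sum_i(-\lambda_{\mathsf a_i}^1\mathsf m_{\mathsf b_i}-\lambda_{\mathsf b_i}^1\mathsf m_{\mathsf a_i})+\gamma^1+\mathsf u^1$; $P_2$ computes $\mathsf y_2=\sum_i(-\lambda_{\mathsf a_i}^2\mathsf m_{\mathsf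 b_i}-\lambda_{\mathsf b_i}^2\mathsf m_{\mathsf a_i})+\gamma^2+\mathsf u^2$; both compute $\mathsf y_3=\sum_i(-\lambda_{\mathsf a_i}^3\mathsf m_{\mathsf b_i}-\lambda_{\mathsf b_i}^3\mathsf m_{\mathsf a_i})$. (2) $P_1$ sends $\mathsf y_1$ to $P_2$, $P_2$ sends $\mathsf y_2$ to $P_1$; they compute $\mathsf z-\mathsf r=\mathsf y_1+\mathsf y_2+\mathsf y_3+\sum_i\mathsf m_{\mathsf a_i}\mathsf m_{\mathsf b_i}$. (3) They set $\mathsf p=(\mathsf z-\mathsf r)^{\mathsf t}$ if $\mathsf{isTr}=1$, else $\mathsf p=\mathsf z-\mathsf r$, and execute $\Pi_{\mathsf{JSh}}(P_1,P_2,\mathsf p)$. (4) Output $[\![\mathsf p]\!]+[\![\mathsf q]\!]$. (5) Verification: $P_3$ computes $\mathsf v=\sum_i(-(\lambda_{\mathsf a_i}^1+\lambda_{\mathsf a_i}^2)\mathsf m_{\mathsf b_i}-(\lambda_{\mathsf b_i}^1+\lambda_{\mathsf b_i}^2)\mathsf m_{\mathsf a_i})+\mathsf u^1+\mathsf u^2+\mathsf w$ and sends $\mathsf H(\mathsf v)$ to $P_1,P_2$, who abort iff $\mathsf H(\mathsf v)\neq\mathsf H(\mathsf y_1+\mathsf y_2+\mathsf s)$. Cost convention (amortized): communication is the limit, as the number $N$ of protocol instances tends to infinity, of (total bits sent)$/N$, where all hash messages are batched and sent once at the end of the whole computation. The communication to $P_3$ in $\Pi_{\mathsf{JSh}}(P_1,P_2,\mathsf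 p)$ is deferred to the verification stage at the end of the computation; its bits are counted in the online communication, but the rounds of the one-time verification stage are not counted. *)

theory Defs
  imports Complex_Main "HOL-Library.Word"
begin

section \<open>Four-party synchronous protocols with batched hashes\<close>

text \<open>
  A protocol is given by local next-message functions: in every round each party computes its
  outgoing messages from its own view only, and all messages of a round are delivered
  simultaneously at the end of the round.  Only honest executions are described, since they
  determine the communication complexity.  The ring of integers modulo a power of two is
  \<^typ>\<open>'l::len word\<close>, with bit length LENGTH('l) at least one.
\<close>

datatype party = P0 | P1 | P2 | P3

definition parties :: "party list" where
  "parties = [P0, P1, P2, P3]"

type_synonym bits = "bool list"

definition enc :: "'l::len word \<Rightarrow> bits" where
  "enc w = map (bit w) [0..<LENGTH('l)]"

definition dec :: "bits \<Rightarrow> 'l::len word" where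
  "dec bs = horner_sum of_bool 2 bs"

subsection \<open>Sharings and views\<close>

datatype comp = Lam1 | Lam2 | Lam3 | Msk

type_synonym 'l sharing = "comp \<Rightarrow> 'l word"

definition is_sharing :: "'l::len sharing \<Rightarrow> 'l word \<Rightarrow> bool" where
  "is_sharing s v \<longleftrightarrow> s Msk = v + (s Lam1 + s Lam2 + s Lam3)"

fun holds :: "party \<Rightarrow> comp set" where
  "holds P0 = {Lam1, Lam2, Lam3}"
| "holds P1 = {Msk, Lam1, Lam3}"
| "holds P2 = {Msk, Lam2, Lam3}"
| "holds P3 = {Msk, Lam1, Lam2}"

type_synonym 'l share = "comp \<Rightarrow> 'l word option"

definition local_share :: "party \<Rightarrow> 'l sharing \<Rightarrow> 'l share" where
  "local_share p s = (\<lambda>c. Some (s c)) |` holds p"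

definition share_add :: "'l::len share \<Rightarrow> 'l share \<Rightarrow> 'l share" where
  "share_add x y = (\<lambda>c. case (x c, y c) of (Some v, Some w) \<Rightarrow> Some (v + w) | _ \<Rightarrow> None)"

text \<open>Names of the common random elements used by one instance of the protocol.\<close>

datatype coin = U1 | U2 | S1 | S2 | LamQ2 | LamP1 | LamP2 | LamP3

record (overloaded) 'l view =
  a_share :: "nat \<Rightarrow> 'l share"
  b_share :: "nat \<Rightarrow> 'l share"
  common :: "party set \<Rightarrow> (coin \<Rightarrow> 'l word) option"
  inbox :: "(party \<times> bits) list"

text \<open>
  The initial view of party \<open>p\<close> in instance \<open>t\<close>.  The keys are set up once for all instances; a
  common random element of the parties in \<open>S\<close> is the value of the pseudorandom function under
  the key of \<open>S\<close> at an input specific to the instance and to the element.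
\<close>

definition init_view ::
    "('k \<Rightarrow> nat \<times> coin \<Rightarrow> 'l word) \<Rightarrow> (party set \<Rightarrow> 'k)
     \<Rightarrow> (nat \<Rightarrow> nat \<Rightarrow> 'l sharing) \<Rightarrow> (nat \<Rightarrow> nat \<Rightarrow> 'l sharing) \<Rightarrow> nat \<Rightarrow> party \<Rightarrow> 'l view" where
  "init_view F key sa sb t p =
     \<lparr> a_share = (\<lambda>i. local_share p (sa t i)),
       b_share = (\<lambda>i. local_share p (sb t i)),
       common = (\<lambda>S. if p \<in> S \<and> 2 \<le> card S then Some (\<lambda>c. F (key S) (t, c)) else None),
       inbox = [] \<rparr>"

subsection \<open>Executions\<close>

text \<open>
  \<open>Send k x\<close> transmits \<open>x\<close> to party \<open>k\<close> in the current round.  \<open>SendHash k x\<close> transmits nothing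
  in the current round: \<open>x\<close> is queued as part of the input of the hash that is sent to \<open>k\<close> at the
  end of the whole computation.
\<close>

datatype action = Send party bits | SendHash party bits

type_synonym 'v round = "party \<Rightarrow> 'v \<Rightarrow> action list"

text \<open>A message or queued hash input: sender, receiver and content.\<close>

type_synonym packet = "party \<times> party \<times> bits"

definition actions :: "'v round \<Rightarrow> (party \<Rightarrow> 'v) \<Rightarrow> (party \<times> action) list" where
  "actions f \<sigma> = concat (map (\<lambda>p. map (Pair p) (f p (\<sigma> p))) parties)"

definition sent :: "(party \<times> action) list \<Rightarrow> packet list" where
  "sent as = concat (map (\<lambda>(p, act). case act of Send k x \<Rightarrow> [(p, k, x)] | SendHash k x \<Rightarrow> []) as)"

definition queued :: "(party \<times> action) list \<Rightarrow> packet list" where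
  "queued as = concat (map (\<lambda>(p, act). case act of Send k x \<Rightarrow> [] | SendHash k x \<Rightarrow> [(p, k, x)]) as)"

definition deliver :: "packet list \<Rightarrow> (party \<Rightarrow> 'l view) \<Rightarrow> party \<Rightarrow> 'l view" where
  "deliver ms \<sigma> p =
     (\<sigma> p)\<lparr> inbox := inbox (\<sigma> p) @ map (\<lambda>(i, k, x). (i, x)) (filter (\<lambda>(i, k, x). k = p) ms) \<rparr>"

text \<open>The transcript (one entry per round) and the final views.\<close>

primrec run :: "'l view round list \<Rightarrow> (party \<Rightarrow> 'l view)
    \<Rightarrow> (party \<times> action) list list \<times> (party \<Rightarrow> 'l view)" where
  "run [] \<sigma> = ([], \<sigma>)"
| "run (f # fs) \<sigma> =
     (let as = actions f \<sigma>; (tr, \<sigma>') = run fs (deliver (sent as) \<sigma>) in (as # tr, \<sigma>'))"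

text \<open>
  The verification rounds are executed at the end of the whole computation.  A party expecting
  \<open>(i, x)\<close> checks that the value hashed by party \<open>i\<close> is \<open>x\<close>; expectations and results are computed
  from the final view.
\<close>

record (overloaded) 'l protocol =
  preprocessing :: "'l view round list"
  online :: "'l view round list"
  verification :: "'l view round list"
  expected_preprocessing :: "party \<Rightarrow> 'l view \<Rightarrow> (party \<times> bits) list"
  expected_online :: "party \<Rightarrow> 'l view \<Rightarrow> (party \<times> bits) list"
  result_share :: "party \<Rightarrow> 'l view \<Rightarrow> 'l share"

definition preprocessing_run where
  "preprocessing_run \<Pi> \<sigma> = run (preprocessing \<Pi>) \<sigma>"

definition online_run where
  "online_run \<Pi> \<sigma> = run (online \<Pi>) (snd (preprocessing_run \<Pi> \<sigma>))"

definition verification_run where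
  "verification_run \<Pi> \<sigma> = run (verification \<Pi>) (snd (online_run \<Pi> \<sigma>))"

definition final_view where
  "final_view \<Pi> \<sigma> = snd (verification_run \<Pi> \<sigma>)"

subsection \<open>Costs\<close>

text \<open>
  \<open>digest H qs i k\<close> is the single hash that \<open>i\<close> sends to \<open>k\<close> for all its queued inputs; it is sent
  only if there is at least one such input.
\<close>

definition digest :: "(bits \<Rightarrow> bits) \<Rightarrow> packet list \<Rightarrow> party \<Rightarrow> party \<Rightarrow> bits" where
  "digest H qs i k = H (concat (map (snd \<circ> snd) (filter (\<lambda>(i', k', x). i' = i \<and> k' = k) qs)))"

definition hash_messages :: "(bits \<Rightarrow> bits) \<Rightarrow> packet list \<Rightarrow> packet list" where
  "hash_messages H qs =
     map (\<lambda>(i, k). (i, k, digest H qs i k)) (remdups (map (\<lambda>(i, k, x). (i, k)) qs))"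

definition bit_count :: "packet list \<Rightarrow> nat" where
  "bit_count ms = sum_list (map (\<lambda>(i, k, x). length x) ms)"

text \<open>
  Instance \<open>t < N\<close> starts from the views \<open>\<sigma> t\<close>.  The deferred messages and the hashes of the
  verification stage are counted as online communication; hashes belonging to joint-sends of the
  preprocessing are counted as preprocessing communication.
\<close>

definition preprocessing_queue where
  "preprocessing_queue \<Pi> \<sigma> N =
     concat (map (\<lambda>t. queued (concat (fst (preprocessing_run \<Pi> (\<sigma> t))))) [0..<N])"

definition online_queue where
  "online_queue \<Pi> \<sigma> N =
     concat (map (\<lambda>t. queued (concat (fst (online_run \<Pi> (\<sigma> t)) @ fst (verification_run \<Pi> (\<sigma> t)))))
       [0..<N])"

definition preprocessing_messages where
  "preprocessing_messages H \<Pi> \<sigma> N =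
     concat (map (\<lambda>t. sent (concat (fst (preprocessing_run \<Pi> (\<sigma> t))))) [0..<N])
     @ hash_messages H (preprocessing_queue \<Pi> \<sigma> N)"

definition online_messages where
  "online_messages H \<Pi> \<sigma> N =
     concat (map (\<lambda>t. sent (concat (fst (online_run \<Pi> (\<sigma> t)) @ fst (verification_run \<Pi> (\<sigma> t)))))
       [0..<N])
     @ hash_messages H (online_queue \<Pi> \<sigma> N)"

text \<open>The rounds of the verification stage are not counted.\<close>

definition online_rounds where
  "online_rounds \<Pi> \<sigma> = length (filter (\<lambda>as. sent as \<noteq> []) (fst (online_run \<Pi> \<sigma>)))"

definition amortized_cost :: "(nat \<Rightarrow> packet list) \<Rightarrow> real \<Rightarrow> bool" where
  "amortized_cost msgs c \<longleftrightarrow> (\<lambda>N. real (bit_count (msgs N)) / real N) \<longlonglongrightarrow> c"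

text \<open>Result of party \<open>k\<close> in instance \<open>t\<close> of \<open>N\<close>; \<open>None\<close> means that \<open>k\<close> aborts.\<close>

definition expected_queue where
  "expected_queue ex \<Pi> \<sigma> N k =
     concat (map (\<lambda>t. map (\<lambda>(i, x). (i, k, x)) (ex k (final_view \<Pi> (\<sigma> t) k))) [0..<N])"

definition aborts where
  "aborts H \<Pi> \<sigma> N k \<longleftrightarrow>
     (\<exists>i. digest H (preprocessing_queue \<Pi> \<sigma> N) i k
            \<noteq> digest H (expected_queue (expected_preprocessing \<Pi>) \<Pi> \<sigma> N k) i k
        \<or> digest H (online_queue \<Pi> \<sigma> N) i k
            \<noteq> digest H (expected_queue (expected_online \<Pi>) \<Pi> \<sigma> N k) i k)"

definition result where
  "result H \<Pi> \<sigma> N t k =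
     (if aborts H \<Pi> \<sigma> N k then None else Some (result_share \<Pi> k (final_view \<Pi> (\<sigma> t) k)))"

section \<open>The dot product protocol\<close>

text \<open>
  All quantities are computed by a party from its view \<open>V\<close>.  A value that is not in the view is
  undefined, so an expression is meaningful only for the parties that can compute it.
\<close>

definition sa :: "'l view \<Rightarrow> comp \<Rightarrow> nat \<Rightarrow> 'l word" where
  "sa V c i = the (a_share V i c)"

definition sb :: "'l view \<Rightarrow> comp \<Rightarrow> nat \<Rightarrow> 'l word" where
  "sb V c i = the (b_share V i c)"

definition sample :: "party set \<Rightarrow> coin \<Rightarrow> 'l view \<Rightarrow> 'l word" where
  "sample S c V = the (common V S) c"

definition received :: "party \<Rightarrow> 'l::len view \<Rightarrow> 'l word" where
  "received i V = dec (the (map_of (inbox V) i))"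

definition truncate :: "nat \<Rightarrow> bool \<Rightarrow> 'l::len word \<Rightarrow> 'l word" where
  "truncate f isTr x = (if isTr then signed_drop_bit f x else x)"

subsection \<open>Joint-send and joint sharing\<close>

text \<open>Actions of party \<open>p\<close> when \<open>i\<close> and \<open>j\<close> joint-send \<open>x\<close> to \<open>k\<close>.\<close>

definition jsnd :: "party \<Rightarrow> party \<Rightarrow> bits \<Rightarrow> party \<Rightarrow> party \<Rightarrow> action list" where
  "jsnd i j x k p = (if p = i then [Send k x] else if p = j then [SendHash k x] else [])"

definition lam_q1 :: "'l::len word \<Rightarrow> 'l view \<Rightarrow> 'l word" where
  "lam_q1 v V = - v - sample {P0, P2, P3} LamQ2 V"

definition jsh03_send :: "'l::len word \<Rightarrow> party \<Rightarrow> 'l view \<Rightarrow> action list" where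
  "jsh03_send v p V = jsnd P0 P3 (enc (lam_q1 v V)) P1 p"

definition jsh03_share :: "'l::len word \<Rightarrow> party \<Rightarrow> 'l view \<Rightarrow> 'l share" where
  "jsh03_share v p V =
     [Lam1 \<mapsto> (if p = P1 then received P0 V else lam_q1 v V),
      Lam2 \<mapsto> sample {P0, P2, P3} LamQ2 V,
      Lam3 \<mapsto> 0,
      Msk \<mapsto> 0] |` holds p"

text \<open>
  \<open>P1\<close> and \<open>P2\<close> must know all three masks of \<open>p\<close>, so the first two are common to all
  parties, and the third, which is not held by \<open>P3\<close>, is common to the other three.
\<close>

definition lam_p1 :: "'l view \<Rightarrow> 'l word" where
  "lam_p1 V = sample {P0, P1, P2, P3} LamP1 V"

definition lam_p2 :: "'l view \<Rightarrow> 'l word" where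
  "lam_p2 V = sample {P0, P1, P2, P3} LamP2 V"

definition lam_p3 :: "'l view \<Rightarrow> 'l word" where
  "lam_p3 V = sample {P0, P1, P2} LamP3 V"

definition m_p :: "'l::len word \<Rightarrow> 'l view \<Rightarrow> 'l word" where
  "m_p v V = v + (lam_p1 V + lam_p2 V + lam_p3 V)"

definition jsh12_send :: "'l::len word \<Rightarrow> party \<Rightarrow> 'l view \<Rightarrow> action list" where
  "jsh12_send v p V = jsnd P1 P2 (enc (m_p v V)) P3 p"

definition jsh12_share :: "'l::len word \<Rightarrow> party \<Rightarrow> 'l view \<Rightarrow> 'l share" where
  "jsh12_share v p V =
     [Lam1 \<mapsto> lam_p1 V,
      Lam2 \<mapsto> lam_p2 V,
      Lam3 \<mapsto> lam_p3 V,
      Msk \<mapsto> (if p = P3 then received P1 V else m_p v V)] |` holds p"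

subsection \<open>Preprocessing\<close>

context
  fixes d :: nat
begin

definition gamma1 :: "'l::len view \<Rightarrow> 'l word" where
  "gamma1 V = (\<Sum>i=1..d. sa V Lam1 i * sb V Lam3 i + sa V Lam3 i * sb V Lam1 i
                        + sa V Lam3 i * sb V Lam3 i)"

definition gamma2 :: "'l::len view \<Rightarrow> 'l word" where
  "gamma2 V = (\<Sum>i=1..d. sa V Lam2 i * sb V Lam3 i + sa V Lam3 i * sb V Lam2 i
                        + sa V Lam2 i * sb V Lam2 i)"

definition gamma3 :: "'l::len view \<Rightarrow> 'l word" where
  "gamma3 V = (\<Sum>i=1..d. sa V Lam1 i * sb V Lam2 i + sa V Lam2 i * sb V Lam1 i
                        + sa V Lam1 i * sb V Lam1 i)"

definition u1 :: "'l view \<Rightarrow> 'l word" where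
  "u1 V = sample {P0, P1, P3} U1 V"

definition u2 :: "'l view \<Rightarrow> 'l word" where
  "u2 V = sample {P0, P2, P3} U2 V"

definition s_mask :: "'l::len view \<Rightarrow> 'l word" where
  "s_mask V = sample {P0, P1, P2} S1 V + sample {P0, P1, P2} S2 V"

definition r_val :: "'l::len view \<Rightarrow> 'l word" where
  "r_val V = gamma3 V - u1 V - u2 V"

definition q_val :: "nat \<Rightarrow> bool \<Rightarrow> 'l::len view \<Rightarrow> 'l word" where
  "q_val f isTr V = truncate f isTr (r_val V)"

definition w_val :: "'l::len view \<Rightarrow> 'l word" where
  "w_val V = gamma1 V + gamma2 V + s_mask V"

definition dotp_preprocessing :: "nat \<Rightarrow> bool \<Rightarrow> 'l::len view round" where
  "dotp_preprocessing f isTr p V =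
     jsh03_send (q_val f isTr V) p V @ (if p = P0 then [Send P3 (enc (w_val V))] else [])"

subsection \<open>Online phase\<close>

definition y1_own :: "'l::len view \<Rightarrow> 'l word" where
  "y1_own V = (\<Sum>i=1..d. - sa V Lam1 i * sb V Msk i - sb V Lam1 i * sa V Msk i) + gamma1 V + u1 V"

definition y2_own :: "'l::len view \<Rightarrow> 'l word" where
  "y2_own V = (\<Sum>i=1..d. - sa V Lam2 i * sb V Msk i - sb V Lam2 i * sa V Msk i) + gamma2 V + u2 V"

definition y3 :: "'l::len view \<Rightarrow> 'l word" where
  "y3 V = (\<Sum>i=1..d. - sa V Lam3 i * sb V Msk i - sb V Lam3 i * sa V Msk i)"

definition dotp_online :: "'l::len view round" where
  "dotp_online p V =
     (if p = P1 then [Send P2 (enc (y1_own V))]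
      else if p = P2 then [Send P1 (enc (y2_own V))]
      else [])"

definition y1 :: "party \<Rightarrow> 'l::len view \<Rightarrow> 'l word" where
  "y1 p V = (if p = P1 then y1_own V else received P1 V)"

definition y2 :: "party \<Rightarrow> 'l::len view \<Rightarrow> 'l word" where
  "y2 p V = (if p = P2 then y2_own V else received P2 V)"

definition z_minus_r :: "party \<Rightarrow> 'l::len view \<Rightarrow> 'l word" where
  "z_minus_r p V = y1 p V + y2 p V + y3 V + (\<Sum>i=1..d. sa V Msk i * sb V Msk i)"

definition p_val :: "nat \<Rightarrow> bool \<Rightarrow> party \<Rightarrow> 'l::len view \<Rightarrow> 'l word" where
  "p_val f isTr p V = truncate f isTr (z_minus_r p V)"

subsection \<open>Verification and output\<close>

definition v_val :: "'l::len view \<Rightarrow> 'l word" where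
  "v_val V = (\<Sum>i=1..d. - (sa V Lam1 i + sa V Lam2 i) * sb V Msk i
                       - (sb V Lam1 i + sb V Lam2 i) * sa V Msk i)
             + u1 V + u2 V + received P0 V"

definition dotp_verification :: "nat \<Rightarrow> bool \<Rightarrow> 'l::len view round" where
  "dotp_verification f isTr p V =
     jsh12_send (p_val f isTr p V) p V
     @ (if p = P3 then [SendHash P1 (enc (v_val V)), SendHash P2 (enc (v_val V))] else [])"

definition dotp_expected_preprocessing :: "party \<Rightarrow> 'l::len view \<Rightarrow> (party \<times> bits) list" where
  "dotp_expected_preprocessing p V =
     (if p = P1 then [(P3, enc (received P0 V))] else [])"

definition dotp_expected_online :: "party \<Rightarrow> 'l::len view \<Rightarrow> (party \<times> bits) list" where
  "dotp_expected_online p V =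
     (if p = P1 \<or> p = P2 then [(P3, enc (y1 p V + y2 p V + s_mask V))]
      else if p = P3 then [(P2, enc (received P1 V))]
      else [])"

definition dotp_result :: "nat \<Rightarrow> bool \<Rightarrow> party \<Rightarrow> 'l::len view \<Rightarrow> 'l share" where
  "dotp_result f isTr p V =
     share_add (jsh12_share (p_val f isTr p V) p V) (jsh03_share (q_val f isTr V) p V)"

text \<open>
  Here \<open>f\<close> is the number of truncated low-order bits.  The message of the joint sharing of
  \<open>p\<close> depends on the messages of the online round, and is deferred to the verification stage.
\<close>

definition dotp :: "nat \<Rightarrow> bool \<Rightarrow> 'l::len protocol" where
  "dotp f isTr =
     \<lparr> preprocessing = [dotp_preprocessing f isTr],
       online = [dotp_online],
       verification = [dotp_verification f isTr],
       expected_preprocessing = dotp_expected_preprocessing,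
       expected_online = dotp_expected_online,
       result_share = dotp_result f isTr \<rparr>"

end

end

(*
  A batched hash is sent at most once between each of the sixteen ordered pairs of parties, whatever
  the number N of instances.  The hashes thus contribute O(1) bits in total and vanish after division
  by N, which leaves the ring elements sent in each instance: lam_q1 and w in preprocessing, and
  y1, y2 and the deferred m_p online.
*)

theory Submission
  imports Defs
begin

lemma length_enc [simp]: "length (enc (w :: 'l::len word)) = LENGTH('l)"
  by (simp add: enc_def)

lemma bit_count_append: "bit_count (ms @ ms') = bit_count ms + bit_count ms'"
  by (simp add: bit_count_def)

lemma bit_count_concat: "bit_count (concat mss) = sum_list (map bit_count mss)"
  by (induction mss) (simp_all add: bit_count_append, simp add: bit_count_def)

lemma UNIV_party: "UNIV = {P0, P1, P2, P3}"
  using party.exhaust by auto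

text \<open>A crude count that includes a party paired with itself; any bound that ignores the queue
  suffices.\<close>

lemma card_party_pairs: "card (A :: (party \<times> party) set) \<le> 16"
proof -
  have "finite (UNIV :: party set)" and "card (UNIV :: party set) = 4"
    by (simp_all add: UNIV_party)
  then have "finite (UNIV :: (party \<times> party) set)" and "card (UNIV :: (party \<times> party) set) = 16"
    by (simp_all add: card_cartesian_product flip: UNIV_Times_UNIV)
  then show ?thesis
    using card_mono[of UNIV A] by simp
qed

text \<open>\<open>remdups\<close> leaves one digest per sender-receiver pair, and its length is
  \<kappa> however long the hashed input is.\<close>

lemma bit_count_hash_messages:
  assumes "\<And>x. length (H x) = \<kappa>"
  shows "bit_count (hash_messages H qs) \<le> 16 * \<kappa>"
proof -
  let ?ps = "remdups (map (\<lambda>(i, k, x). (i, k)) qs)"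
  have "bit_count (hash_messages H qs) = sum_list (map (\<lambda>_. \<kappa>) ?ps)"
    unfolding bit_count_def hash_messages_def digest_def map_map
    by (rule arg_cong[where f = sum_list]) (auto simp: assms)
  also have "\<dots> = card (set ?ps) * \<kappa>"
    by (simp add: sum_list_triv length_remdups_card_conv)
  also have "\<dots> \<le> 16 * \<kappa>"
    by (intro mult_right_mono card_party_pairs) simp
  finally show ?thesis .
qed

lemma amortized_cost_batched_hashes:
  assumes H: "\<And>x. length (H x) = \<kappa>" and c: "\<And>t. bit_count (ms t) = c"
  shows "amortized_cost (\<lambda>N. concat (map ms [0..<N]) @ hash_messages H (qs N)) (real c)"
proof -
  define h where "h N = bit_count (hash_messages H (qs N))" for N
  have "(\<lambda>N. real (16 * \<kappa>) / real N) \<longlonglongrightarrow> 0"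
    by (rule lim_const_over_n)
  then have "(\<lambda>N. real (h N) / real N) \<longlonglongrightarrow> 0"
  \<comment> \<open>Squeeze between the constant 0 and \<open>16 * \<kappa> / N\<close>; the
    rotation puts the upper limit first, for the chained fact.\<close>
  proof (rule tendsto_sandwich[OF _ _ tendsto_const, rotated 2])
    show "\<forall>\<^sub>F N in sequentially. real (h N) / real N \<le> real (16 * \<kappa>) / real N"
      unfolding h_def
      by (intro always_eventually allI divide_right_mono of_nat_mono bit_count_hash_messages H) simp
  qed simp
  then have lim: "(\<lambda>N. real c + real (h N) / real N) \<longlonglongrightarrow> real c + 0"
    by (intro tendsto_add tendsto_const)
  have sum: "bit_count (concat (map ms [0..<N])) = N * c" for N
    by (simp add: bit_count_concat o_def c sum_list_triv)
  \<comment> \<open>Only for positive \<open>N\<close>: since \<open>x / 0 = 0\<close>, at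
    \<open>N = 0\<close> the left side is \<open>c\<close> and the right side 0.\<close>
  have "\<forall>\<^sub>F N in sequentially. real c + real (h N) / real N =
      real (bit_count (concat (map ms [0..<N]) @ hash_messages H (qs N))) / real N"
    using eventually_gt_at_top[of 0]
    by eventually_elim (simp add: bit_count_append sum h_def field_simps)
  with lim show ?thesis
    unfolding amortized_cost_def by (simp add: Lim_transform_eventually)
qed

lemmas execution_defs =
  preprocessing_run_def online_run_def verification_run_def dotp_def actions_def parties_def
  sent_def bit_count_def

text \<open>Who sends what is fixed by the round function and \<open>enc\<close> has constant
  length, so neither the views nor truncation affect the count.\<close>

lemma bit_count_dotp_preprocessing:
  fixes \<sigma> :: "party \<Rightarrow> 'l::len view"
  shows "bit_count (sent (concat (fst (preprocessing_run (dotp d f isTr) \<sigma>)))) = 2 * LENGTH('l)"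
  by (simp add: execution_defs dotp_preprocessing_def jsh03_send_def jsnd_def Let_def)

text \<open>The second half of the joint-send by \<open>P2\<close> and the checks by
  \<open>P3\<close> are \<open>SendHash\<close> actions, which \<open>sent\<close> drops.\<close>

lemma bit_count_dotp_online:
  fixes \<sigma> :: "party \<Rightarrow> 'l::len view"
  shows "bit_count (sent (concat (fst (online_run (dotp d f isTr) \<sigma>)
      @ fst (verification_run (dotp d f isTr) \<sigma>)))) = 3 * LENGTH('l)"
  by (simp add: execution_defs dotp_online_def dotp_verification_def jsh12_send_def jsnd_def Let_def)

text \<open>\<open>P1\<close> and \<open>P2\<close> exchange their values simultaneously; the
  message that depends on both belongs to \<open>verification\<close>.\<close>

lemma online_rounds_dotp: "online_rounds (dotp d f isTr) \<sigma> = 1"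
  by (simp add: online_rounds_def execution_defs dotp_online_def Let_def)

theorem lemmaC1:
  fixes d f \<kappa> :: nat
    and isTr :: bool
    and H :: "bits \<Rightarrow> bits"
    and F :: "'k \<Rightarrow> nat \<times> coin \<Rightarrow> 'l::len word"
    and key :: "party set \<Rightarrow> 'k"
    and a b :: "nat \<Rightarrow> nat \<Rightarrow> 'l word"
    and a_sh b_sh :: "nat \<Rightarrow> nat \<Rightarrow> 'l sharing"
  assumes "1 \<le> d"
    and "\<And>x. length (H x) = \<kappa>"
    and "\<And>t i. i \<in> {1..d} \<Longrightarrow> is_sharing (a_sh t i) (a t i)"
    and "\<And>t i. i \<in> {1..d} \<Longrightarrow> is_sharing (b_sh t i) (b t i)"
  shows "amortized_cost
           (preprocessing_messages H (dotp d f isTr) (init_view F key a_sh b_sh))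
           (2 * LENGTH('l))
       \<and> (\<forall>t. online_rounds (dotp d f isTr) (init_view F key a_sh b_sh t) = 1)
       \<and> amortized_cost
           (online_messages H (dotp d f isTr) (init_view F key a_sh b_sh))
           (3 * LENGTH('l))"
proof (intro conjI allI)
  show "amortized_cost
      (preprocessing_messages H (dotp d f isTr) (init_view F key a_sh b_sh)) (2 * LENGTH('l))"
    \<comment> \<open>\<open>preprocessing_messages\<close> occurs here without its argument
      \<open>N\<close>, so its definition is unfolded as a function of \<open>N\<close>.\<close>
    using amortized_cost_batched_hashes[OF assms(2) bit_count_dotp_preprocessing]
    unfolding preprocessing_messages_def[abs_def] by simp
  show "online_rounds (dotp d f isTr) (init_view F key a_sh b_sh t) = 1" for t
    by (rule online_rounds_dotp)
  show "amortized_cost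
      (online_messages H (dotp d f isTr) (init_view F key a_sh b_sh)) (3 * LENGTH('l))"
    using amortized_cost_batched_hashes[OF assms(2) bit_count_dotp_online]
    unfolding online_messages_def[abs_def] by simp
qed

end
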